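(* Let $n\ge1$ and let $\mathrm{MAJ}:\{0,1\}^n\times\{0,1\}^n\to\{0,1\}$ be the majority function, $\mathrm{MAJ}(x,y)=1$ iff $\sum_{i=1}^n x_iy_i\ge\lfloor n/2\rfloor+1$. Then $GH(\mathrm{MAJ})\le (n+2)^2$.
   Context: Garden-hose game of size $s\in\mathbb{N}$: let $A=\{1^A,\dots,s^A\}$, $B=\{1^B,\dots,s^B\}$, $A_\circ=A\cup\{0\}$, and $E=\{\{i^A,i^B\}:1\le i\le s\}$ (the pipes). A game $G$ is given by functions $E_{A_\circ},E_B$ on $\{0,1\}^n$, where $E_{A_\circ}(x)$ is a set of edges (no self-loops) on $A_\circ$ and $E_B(y)$ is a set of edges (no self-loops) on $B$, such that the graphs $(A_\circ,E_{A_\circ}(x))$ and $(B,E_B(y))$ have maximum degree at most $1$. Put $G(x,y)=(A_\circ\cup B,\,E\cup E_{A_\circ}(x)\cup E_B(y))$. There is a unique maximal path $\pi(x,y)$ in $G(x,y)$ starting at $0$ (it consists of $0$ alone if $0$ has degree $0$). $G$ computes $f$ if for all $x,y$ the endpoint of $\pi(x,y)$ lies in $A_\circ$ when $f(x,y)=0$ and in $B$ when $f(x,y)=1$. $GH(f)$ is the smallest size $s$ of a game computing $f$. *)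

theory Defs
  imports Complex_Main "HOL-Library.FuncSet" "HOL-Library.Extended_Nat" "HOL-Library.Sublist"
begin

text \<open>
  Finite simple undirected graphs: a vertex set together with a set of edges, each edge being a
  two-element set of vertices.
\<close>

definition simple_edges :: "'a set \<Rightarrow> 'a set set \<Rightarrow> bool" where
  "simple_edges V E \<longleftrightarrow> E \<subseteq> {{u, v} | u v. u \<in> V \<and> v \<in> V \<and> u \<noteq> v}"

definition degree :: "'a set set \<Rightarrow> 'a \<Rightarrow> nat" where
  "degree E v = card {e \<in> E. v \<in> e}"

definition path :: "'a set \<Rightarrow> 'a set set \<Rightarrow> 'a list \<Rightarrow> bool" where
  "path V E p \<longleftrightarrow>
     p \<noteq> [] \<and> distinct p \<and> set p \<subseteq> V \<and> successively (\<lambda>u v. {u, v} \<in> E) p"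

definition maximal_path_from :: "'a set \<Rightarrow> 'a set set \<Rightarrow> 'a \<Rightarrow> 'a list \<Rightarrow> bool" where
  "maximal_path_from V E v p \<longleftrightarrow>
     path V E p \<and> hd p = v \<and> (\<forall>q. path V E q \<and> prefix p q \<longrightarrow> q = p)"

text \<open>
  \<open>Zero\<close> is the tap $0$, and \<open>Alice i\<close>, \<open>Bob i\<close> are the two ends $i^A$, $i^B$ of the $i$-th pipe.
\<close>

datatype vertex = Zero | Alice nat | Bob nat

definition A_verts :: "nat \<Rightarrow> vertex set" where
  "A_verts s = Alice ` {1..s}"

definition A0_verts :: "nat \<Rightarrow> vertex set" where
  "A0_verts s = A_verts s \<union> {Zero}"

definition B_verts :: "nat \<Rightarrow> vertex set" where
  "B_verts s = Bob ` {1..s}"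

definition pipes :: "nat \<Rightarrow> vertex set set" where
  "pipes s = {{Alice i, Bob i} | i. i \<in> {1..s}}"

text \<open>Bit strings are extensional functions on \<open>{1..n}\<close>, so that there are exactly $2^n$ of them.\<close>

type_synonym bitstring = "nat \<Rightarrow> nat"

definition bitstrings :: "nat \<Rightarrow> bitstring set" where
  "bitstrings n = {1..n} \<rightarrow>\<^sub>E {0, 1}"

definition gh_game ::
  "nat \<Rightarrow> nat \<Rightarrow> (bitstring \<Rightarrow> vertex set set) \<Rightarrow> (bitstring \<Rightarrow> vertex set set) \<Rightarrow> bool" where
  "gh_game n s EA EB \<longleftrightarrow>
     (\<forall>x \<in> bitstrings n.
        simple_edges (A0_verts s) (EA x) \<and> (\<forall>v \<in> A0_verts s. degree (EA x) v \<le> 1)) \<and>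
     (\<forall>y \<in> bitstrings n.
        simple_edges (B_verts s) (EB y) \<and> (\<forall>v \<in> B_verts s. degree (EB y) v \<le> 1))"

definition gh_verts :: "nat \<Rightarrow> vertex set" where
  "gh_verts s = A0_verts s \<union> B_verts s"

definition gh_edges ::
  "nat \<Rightarrow> (bitstring \<Rightarrow> vertex set set) \<Rightarrow> (bitstring \<Rightarrow> vertex set set) \<Rightarrow>
   bitstring \<Rightarrow> bitstring \<Rightarrow> vertex set set" where
  "gh_edges s EA EB x y = pipes s \<union> EA x \<union> EB y"

definition gh_path ::
  "nat \<Rightarrow> (bitstring \<Rightarrow> vertex set set) \<Rightarrow> (bitstring \<Rightarrow> vertex set set) \<Rightarrow>
   bitstring \<Rightarrow> bitstring \<Rightarrow> vertex list" where
  "gh_path s EA EB x y =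
     (THE p. maximal_path_from (gh_verts s) (gh_edges s EA EB x y) Zero p)"

definition gh_computes ::
  "nat \<Rightarrow> nat \<Rightarrow> (bitstring \<Rightarrow> vertex set set) \<Rightarrow> (bitstring \<Rightarrow> vertex set set) \<Rightarrow>
   (bitstring \<Rightarrow> bitstring \<Rightarrow> nat) \<Rightarrow> bool" where
  "gh_computes n s EA EB f \<longleftrightarrow>
     (\<forall>x \<in> bitstrings n. \<forall>y \<in> bitstrings n.
        (f x y = 0 \<longrightarrow> last (gh_path s EA EB x y) \<in> A0_verts s) \<and>
        (f x y = 1 \<longrightarrow> last (gh_path s EA EB x y) \<in> B_verts s))"

text \<open>
  The infimum is taken in \<^typ>\<open>enat\<close>, where it is attained for a nonempty set and \<open>\<infinity>\<close> for the empty
  one: a finite upper bound on \<open>GH n f\<close> therefore includes the existence of a game computing \<open>f\<close>.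
\<close>

definition GH :: "nat \<Rightarrow> (bitstring \<Rightarrow> bitstring \<Rightarrow> nat) \<Rightarrow> enat" where
  "GH n f = Inf {enat s | s. \<exists>EA EB. gh_game n s EA EB \<and> gh_computes n s EA EB f}"

definition MAJ :: "nat \<Rightarrow> bitstring \<Rightarrow> bitstring \<Rightarrow> nat" where
  "MAJ n x y = (if (\<Sum>i=1..n. x i * y i) \<ge> n div 2 + 1 then 1 else 0)"

text \<open>The description in \<^const>\<open>gh_path\<close> is always proper.\<close>

lemma degree_le_1_unique:
  assumes "simple_edges V E" "finite V" "\<forall>v \<in> V. degree E v \<le> 1"
    and "e \<in> E" "e' \<in> E" "v \<in> e" "v \<in> e'"
  shows "e = e'"
proof -
  have "E \<subseteq> Pow V" using assms(1) by (auto simp: simple_edges_def)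
  then have fin: "finite {e \<in> E. v \<in> e}" and "v \<in> V"
    using assms finite_subset[of E "Pow V"] by auto
  then have "card {e \<in> E. v \<in> e} \<le> Suc 0" using assms(3) by (auto simp: degree_def)
  then show ?thesis using fin assms(4-7) by (auto simp: card_le_Suc0_iff_eq)
qed

lemma ex1_gh_path:
  assumes game: "gh_game n s EA EB" and x: "x \<in> bitstrings n" and y: "y \<in> bitstrings n"
  shows "\<exists>!p. maximal_path_from (gh_verts s) (gh_edges s EA EB x y) Zero p"
proof -
  let ?V = "gh_verts s" and ?E = "gh_edges s EA EB x y"
  have fin: "finite (A0_verts s)" "finite (B_verts s)" "finite ?V"
    by (auto simp: gh_verts_def A0_verts_def A_verts_def B_verts_def)
  have A: "simple_edges (A0_verts s) (EA x)" "\<forall>v \<in> A0_verts s. degree (EA x) v \<le> 1"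
    and B: "simple_edges (B_verts s) (EB y)" "\<forall>v \<in> B_verts s. degree (EB y) v \<le> 1"
    using game x y by (auto simp: gh_game_def)
  have uA: "e = e'" if "e \<in> EA x" "e' \<in> EA x" "v \<in> e" "v \<in> e'" for e e' v
    using degree_le_1_unique[OF A(1) fin(1) A(2)] that by blast
  have uB: "e = e'" if "e \<in> EB y" "e' \<in> EB y" "v \<in> e" "v \<in> e'" for e e' v
    using degree_le_1_unique[OF B(1) fin(2) B(2)] that by blast
  have uP: "e = e'" if "e \<in> pipes s" "e' \<in> pipes s" "v \<in> e" "v \<in> e'" for e e' v
    using that by (auto simp: pipes_def)
  have EA_sub: "v \<in> A0_verts s" if "e \<in> EA x" "v \<in> e" for e v
    using A(1) that by (auto simp: simple_edges_def)
  have EB_sub: "v \<in> B_verts s" if "e \<in> EB y" "v \<in> e" for e v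
    using B(1) that by (auto simp: simple_edges_def)
  have disj: "A0_verts s \<inter> B_verts s = {}"
    by (auto simp: A0_verts_def A_verts_def B_verts_def)
  have ZeroE: "e \<in> EA x" if "e \<in> ?E" "Zero \<in> e" for e
    using that EB_sub[of e Zero] by (auto simp: gh_edges_def pipes_def B_verts_def)
  have deg2: "e1 = e2 \<or> e1 = e3 \<or> e2 = e3"
    if "e1 \<in> ?E" "e2 \<in> ?E" "e3 \<in> ?E" "v \<in> e1" "v \<in> e2" "v \<in> e3" for e1 e2 e3 v
  proof -
    have "\<not> (e \<in> EA x \<and> e' \<in> EB y)" if "v \<in> e" "v \<in> e'" for e e'
      using that EA_sub EB_sub disj by blast
    then show ?thesis
      using that uA[of _ _ v] uB[of _ _ v] uP[of _ _ v] unfolding gh_edges_def Un_iff by metis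
  qed
  have comparable: "prefix p q \<or> prefix q p"
    if p: "path ?V ?E p" "hd p = Zero" and q: "path ?V ?E q" "hd q = Zero" for p q
  proof (rule ccontr)
    assume "\<not> (prefix p q \<or> prefix q p)"
    then have "p \<parallel> q" by (simp add: parallel_def)
    then obtain r b bs c cs where ne: "b \<noteq> c" and pq: "p = r @ b # bs" "q = r @ c # cs"
      using parallel_decomp by blast
    have "r \<noteq> []" using p(2) q(2) ne pq by auto
    then obtain r' u where r: "r = r' @ [u]" by (metis rev_exhaust)
    have ub: "{u, b} \<in> ?E" and uc: "{u, c} \<in> ?E"
      using p(1) q(1) pq r by (auto simp: path_def successively_append_iff)
    show False
    proof (cases r' rule: rev_cases)
      case Nil
      then have "u = Zero" using p(2) pq r by simp
      then have "{u, b} = {u, c}" using uA[of "{u, b}" "{u, c}" u] ZeroE ub uc by simp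
      then show False using ne by (auto simp: doubleton_eq_iff)
    next
      case (snoc r'' w)
      have wu: "{w, u} \<in> ?E"
        using p(1) pq r snoc by (auto simp: path_def successively_append_iff)
      have "w \<noteq> b" "w \<noteq> c" "w \<noteq> u" "u \<noteq> b" "u \<noteq> c"
        using p(1) q(1) pq r snoc by (auto simp: path_def)
      then show False
        using deg2[OF wu ub uc, of u] ne by (auto simp: doubleton_eq_iff)
    qed
  qed
  define P where "P = {p. path ?V ?E p \<and> hd p = Zero}"
  have "P \<subseteq> {p. set p \<subseteq> ?V \<and> length p \<le> card ?V}"
    using fin(3) by (auto simp: P_def path_def distinct_card[symmetric] intro: card_mono)
  then have "finite P"
    using finite_lists_length_le[OF fin(3)] finite_subset by blast
  moreover have "[Zero] \<in> P"
    by (simp add: P_def path_def gh_verts_def A0_verts_def)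
  ultimately have "Max (length ` P) \<in> length ` P" by (intro Max_in) auto
  then obtain p where p: "p \<in> P" and "length p = Max (length ` P)" by force
  then have pmax: "\<forall>q \<in> P. length q \<le> length p" using \<open>finite P\<close> by simp
  have hd_prefix: "hd q = hd p" if "prefix p q" "p \<noteq> []" for p q :: "vertex list"
    using that by (auto simp: prefix_def)
  show ?thesis
  proof (rule ex1I[of _ p])
    show "maximal_path_from ?V ?E Zero p"
      unfolding maximal_path_from_def
    proof (intro conjI allI impI)
      show "path ?V ?E p" "hd p = Zero" using p by (auto simp: P_def)
      fix q assume q: "path ?V ?E q \<and> prefix p q"
      then have "q \<in> P" using p hd_prefix[of p q] by (auto simp: P_def path_def)
      then show "q = p" using pmax q by (auto simp: prefix_def)
    qed
    then show "q = p" if "maximal_path_from ?V ?E Zero q" for q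
      using that comparable[of p q] unfolding maximal_path_from_def by blast
  qed
qed

end

theory Submission
  imports Defs
begin

text \<open>
  The hose runs through the positions \<open>j\<close> with \<open>x j = 1\<close> in increasing order and records in the
  choice of the pipe the number \<open>c\<close> of common ones seen so far. For every position \<open>j\<close> and every
  counter value \<open>c\<close> below the threshold there are two pipes: a query, by which Alice sends the
  water to Bob, and a reply, by which it comes back. Bob connects the query \<open>(c, j)\<close> with the reply
  \<open>(c + y j, j)\<close>, and Alice connects the reply \<open>(c, j)\<close> with the query \<open>(c, j')\<close>, where \<open>j'\<close> is her
  next position. When the counter reaches the threshold, Bob has no reply to offer and the water
  stays with him; when Alice runs out of positions, it stays with her.
\<close>

section \<open>Pipe numbering and the edges of the two players\<close>

definition code :: "nat \<Rightarrow> nat \<Rightarrow> nat \<Rightarrow> nat" where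
  "code n a j = a * Suc n + j"

text \<open>A pipe number has two digits in base \<open>n + 1\<close>, a row and the position
  \<open>j\<close>. The parity of the row separates queries from replies, and counters below
  \<open>t\<close> occupy the rows below \<open>2 * t\<close>.\<close>

abbreviation query :: "nat \<Rightarrow> nat \<Rightarrow> nat \<Rightarrow> nat" where
  "query n c j \<equiv> code n (2 * c) j"

abbreviation reply :: "nat \<Rightarrow> nat \<Rightarrow> nat \<Rightarrow> nat" where
  "reply n c j \<equiv> code n (Suc (2 * c)) j"

text \<open>The tap takes the place of a reply at the position \<open>0\<close>.\<close>

definition reply_end :: "nat \<Rightarrow> nat \<Rightarrow> nat \<Rightarrow> vertex" where
  "reply_end n c j = (if j = 0 then Zero else Alice (reply n c j))"

text \<open>The value \<open>j = 0\<close> marks the start at the tap. Demanding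
  \<open>x j = 1\<close> otherwise leaves \<open>j'\<close> a single predecessor, so that no query
  receives two of Alice's edges.\<close>

definition next_one :: "nat \<Rightarrow> bitstring \<Rightarrow> nat \<Rightarrow> nat \<Rightarrow> bool" where
  "next_one n x j j' \<longleftrightarrow>
     j < j' \<and> j' \<le> n \<and> (j = 0 \<or> x j = 1) \<and> x j' = 1 \<and> (\<forall>i. j < i \<and> i < j' \<longrightarrow> x i = 0)"

text \<open>The tap is the same vertex for every \<open>c\<close>; tying \<open>j = 0\<close> to
  \<open>c = 0\<close> keeps it from getting one edge per counter value.\<close>

definition alice_edges :: "nat \<Rightarrow> nat \<Rightarrow> bitstring \<Rightarrow> vertex set set" where
  "alice_edges n t x =
     {{reply_end n c j, Alice (query n c j')} | c j j'.
        c < t \<and> (j = 0 \<longrightarrow> c = 0) \<and> next_one n x j j'}"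

definition bob_edges :: "nat \<Rightarrow> nat \<Rightarrow> bitstring \<Rightarrow> vertex set set" where
  "bob_edges n t y =
     {{Bob (query n c j), Bob (reply n (c + y j) j)} | c j. c + y j < t \<and> 1 \<le> j \<and> j \<le> n}"

section \<open>Injectivity of the numbering and degree bounds\<close>

lemma code_eq_iff:
  assumes "j \<le> n" "j' \<le> n"
  shows "code n a j = code n a' j' \<longleftrightarrow> a = a' \<and> j = j'"
proof
  assume eq: "code n a j = code n a' j'"
  have "code n a j div Suc n = a" "code n a' j' div Suc n = a'"
    using assms by (simp_all add: code_def del: mult_Suc_right)
  moreover have "code n a j mod Suc n = j" "code n a' j' mod Suc n = j'"
    using assms by (simp_all add: code_def del: mult_Suc_right)
  ultimately show "a = a' \<and> j = j'" using eq by metis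
qed simp

lemma code_bounds:
  assumes "a < m" "1 \<le> j" "j \<le> n"
  shows "1 \<le> code n a j" "code n a j \<le> m * Suc n"
proof -
  have "Suc a * Suc n \<le> m * Suc n" using assms(1) by (intro mult_le_mono1) simp
  then show "1 \<le> code n a j" "code n a j \<le> m * Suc n" using assms by (auto simp: code_def)
qed

lemma degree_le_1I:
  assumes "\<And>e e'. e \<in> E \<Longrightarrow> e' \<in> E \<Longrightarrow> v \<in> e \<Longrightarrow> v \<in> e' \<Longrightarrow> e = e'"
  shows "degree E v \<le> 1"
\<comment> \<open>An infinite set has \<open>card\<close> 0 by default, so the bound holds there
  too.\<close>
proof (cases "finite {e \<in> E. v \<in> e}")
  case True
  then show ?thesis using assms by (auto simp: degree_def card_le_Suc0_iff_eq)
qed (simp add: degree_def)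

text \<open>If two such pairs shared only one end, the nearer of the other two ends would lie
  strictly inside the longer gap, where \<open>x\<close> vanishes, although \<open>x\<close> is 1
  there.\<close>

lemma next_one_unique:
  assumes "next_one n x j k" "next_one n x j' k'" "j = j' \<or> k = k'"
  shows "j = j' \<and> k = k'"
proof -
  have "\<not> j < j'" if "next_one n x j k" "next_one n x j' k'" "k = k'" for j k j' k'
    using that unfolding next_one_def by (metis not_less_zero zero_neq_one)
  moreover have "\<not> k < k'" if "next_one n x j k" "next_one n x j' k'" "j = j'" for j k j' k'
    using that unfolding next_one_def by (metis zero_neq_one)
  ultimately show ?thesis using assms by (metis linorder_neqE_nat)
qed

lemma next_one_le:
  assumes "next_one n x j j'"
  shows "j \<le> n" "1 \<le> j'" "j' \<le> n" "j < j'"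
  using assms by (auto simp: next_one_def)

lemma reply_end_eq_iff:
  assumes "j \<le> n" "j' \<le> n" "j = 0 \<longrightarrow> c = 0" "j' = 0 \<longrightarrow> c' = 0"
  shows "reply_end n c j = reply_end n c' j' \<longleftrightarrow> c = c' \<and> j = j'"
  using assms by (auto simp: reply_end_def code_eq_iff)

lemma reply_end_neq_query:
  assumes "j \<le> n" "j' \<le> n"
  shows "reply_end n c j \<noteq> Alice (query n c' j')"
proof -
  have "Suc (2 * c) \<noteq> 2 * c'" by presburger
  then show ?thesis using assms by (auto simp: reply_end_def code_eq_iff)
qed

text \<open>Each edge is recovered from either of its ends. An end on Alice's side gives
  \<open>c\<close> and one position, and \<open>next_one\<close> determines the other. An end on
  Bob's side gives \<open>j\<close>, and \<open>y j\<close> then converts between the two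
  counters.\<close>

lemma game_edges:
  "gh_game n (2 * t * Suc n) (alice_edges n t) (bob_edges n t)"
  unfolding gh_game_def
proof (intro conjI ballI)
  fix x :: bitstring
  show "simple_edges (A0_verts (2 * t * Suc n)) (alice_edges n t x)"
    unfolding simple_edges_def
  proof
    fix e assume "e \<in> alice_edges n t x"
    then obtain c j k where e: "e = {reply_end n c j, Alice (query n c k)}"
      and c: "c < t" "next_one n x j k"
      unfolding alice_edges_def mem_Collect_eq by blast
    note k = next_one_le[OF c(2)]
    have "reply_end n c j \<noteq> Alice (query n c k)" using k by (simp add: reply_end_neq_query)
    moreover have "reply_end n c j \<in> A0_verts (2 * t * Suc n)"
      using c(1) k code_bounds[of "Suc (2 * c)" "2 * t" j n]
      by (auto simp: reply_end_def A0_verts_def A_verts_def)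
    moreover have "Alice (query n c k) \<in> A0_verts (2 * t * Suc n)"
      using c(1) k code_bounds[of "2 * c" "2 * t" k n] by (auto simp: A0_verts_def A_verts_def)
    ultimately show "e \<in> {{u, v} |u v. u \<in> A0_verts (2 * t * Suc n) \<and>
        v \<in> A0_verts (2 * t * Suc n) \<and> u \<noteq> v}"
      using e by blast
  qed
  fix v
  show "degree (alice_edges n t x) v \<le> 1"
  proof (rule degree_le_1I)
    fix e e' assume "e \<in> alice_edges n t x" "e' \<in> alice_edges n t x" and v: "v \<in> e" "v \<in> e'"
    then obtain c j k c' j' k' where
      e: "e = {reply_end n c j, Alice (query n c k)}" "j = 0 \<longrightarrow> c = 0" "next_one n x j k" and
      e': "e' = {reply_end n c' j', Alice (query n c' k')}" "j' = 0 \<longrightarrow> c' = 0"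
        "next_one n x j' k'"
      unfolding alice_edges_def mem_Collect_eq by blast
    note le = next_one_le[OF e(3)] next_one_le[OF e'(3)]
    \<comment> \<open>By parity, a shared vertex must play the same role in both edges.\<close>
    have neq: "reply_end n c j \<noteq> Alice (query n c' k')" "reply_end n c' j' \<noteq> Alice (query n c k)"
      using le by (simp_all add: reply_end_neq_query)
    consider "v = reply_end n c j" | "v = Alice (query n c k)" using v(1) e(1) by blast
    then have same: "c = c' \<and> (j = j' \<or> k = k')"
    proof cases
      case 1
      then have "reply_end n c j = reply_end n c' j'" using v(2) neq(1) unfolding e'(1) by blast
      then show ?thesis using le e(2) e'(2) by (simp add: reply_end_eq_iff)
    next
      case 2
      then have "Alice (query n c k) = Alice (query n c' k')"
        using v(2) neq(2) unfolding e'(1) by (metis insertE singletonD)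
      then show ?thesis using le by (simp add: code_eq_iff)
    qed
    have "j = j' \<and> k = k'" by (rule next_one_unique[OF e(3) e'(3) conjunct2[OF same]])
    then show "e = e'" using same e(1) e'(1) by blast
  qed
next
  fix y :: bitstring
  show "simple_edges (B_verts (2 * t * Suc n)) (bob_edges n t y)"
    unfolding simple_edges_def
  proof
    fix e assume "e \<in> bob_edges n t y"
    then obtain c j where e: "e = {Bob (query n c j), Bob (reply n (c + y j) j)}"
      and c: "c + y j < t" "1 \<le> j" "j \<le> n"
      by (auto simp: bob_edges_def)
    have "2 * c \<noteq> Suc (2 * (c + y j))" by presburger
    then have "Bob (query n c j) \<noteq> Bob (reply n (c + y j) j)" using c by (simp add: code_eq_iff)
    moreover have "Bob (query n c j) \<in> B_verts (2 * t * Suc n)"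
      using c code_bounds[of "2 * c" "2 * t" j n] by (auto simp: B_verts_def)
    moreover have "Bob (reply n (c + y j) j) \<in> B_verts (2 * t * Suc n)"
      using c code_bounds[of "Suc (2 * (c + y j))" "2 * t" j n] by (auto simp: B_verts_def)
    ultimately show "e \<in> {{u, v} |u v. u \<in> B_verts (2 * t * Suc n) \<and>
        v \<in> B_verts (2 * t * Suc n) \<and> u \<noteq> v}"
      using e by blast
  qed
  fix v
  show "degree (bob_edges n t y) v \<le> 1"
  proof (rule degree_le_1I)
    fix e e' assume "e \<in> bob_edges n t y" "e' \<in> bob_edges n t y" and v: "v \<in> e" "v \<in> e'"
    then obtain c j c' j' where
      e: "e = {Bob (query n c j), Bob (reply n (c + y j) j)}" "j \<le> n" and
      e': "e' = {Bob (query n c' j'), Bob (reply n (c' + y j') j')}" "j' \<le> n"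
      unfolding bob_edges_def mem_Collect_eq by blast
    \<comment> \<open>Parity again, in the form in which the simplifier leaves
      \<open>2 * (c + y j)\<close>.\<close>
    have "2 * a \<noteq> Suc (2 * b + 2 * d)" "Suc (2 * b + 2 * d) \<noteq> 2 * a" for a b d :: nat
      by presburger+
    then have "c = c' \<and> j = j'" using v e e' by (auto simp: code_eq_iff)
    then show "e = e'" using e e' by simp
  qed
qed

section \<open>Finding the endpoint of the maximal path\<close>

lemma maximal_path_fromI:
  assumes "path V E p" "hd p = v" "\<And>u. {last p, u} \<in> E \<Longrightarrow> u \<in> set p"
  shows "maximal_path_from V E v p"
  unfolding maximal_path_from_def
proof (intro conjI allI impI)
  fix q assume q: "path V E q \<and> prefix p q"
  then obtain r where r: "q = p @ r" by (auto simp: prefix_def)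
  show "q = p"
  proof (cases r)
    case (Cons u us)
    then have "{last p, u} \<in> E" "u \<notin> set p"
      using q r assms(1) by (auto simp: path_def successively_append_iff)
    then show ?thesis using assms(3) by blast
  qed (simp add: r)
qed (use assms in auto)

text \<open>The maximal path from the tap is unique, so it suffices to exhibit one path whose last
  vertex has only visited neighbours.\<close>

lemma last_gh_path:
  assumes "gh_game n s EA EB" "x \<in> bitstrings n" "y \<in> bitstrings n"
    and "path (gh_verts s) (gh_edges s EA EB x y) p" "hd p = Zero"
    and "\<And>u. {last p, u} \<in> gh_edges s EA EB x y \<Longrightarrow> u \<in> set p"
  shows "last (gh_path s EA EB x y) = last p"
  using the1_equality[OF ex1_gh_path[OF assms(1-3)] maximal_path_fromI[OF assms(4-6)]]
  by (simp add: gh_path_def)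

text \<open>Reads the position off a vertex. The path moves through the columns in increasing order,
  which is how it is seen to be free of repetitions.\<close>

fun column :: "nat \<Rightarrow> vertex \<Rightarrow> nat" where
  "column n Zero = 0"
| "column n (Alice m) = m mod Suc n"
| "column n (Bob m) = m mod Suc n"

lemma code_mod: "j \<le> n \<Longrightarrow> code n a j mod Suc n = j"
  by (simp add: code_def del: mult_Suc_right)

lemma path_append:
  assumes "path V E p" "path V E q" "{last p, hd q} \<in> E" "set p \<inter> set q = {}"
  shows "path V E (p @ q)"
  using assms by (auto simp: path_def successively_append_iff)

section \<open>Following the water for fixed inputs\<close>

context
  fixes n t :: nat and x y :: bitstring
  assumes t: "t \<ge> 1" and x: "x \<in> bitstrings n" and y: "y \<in> bitstrings n"
begin

abbreviation (input) "V \<equiv> gh_verts (2 * t * Suc n)"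
abbreviation (input) "E \<equiv> gh_edges (2 * t * Suc n) (alice_edges n t) (bob_edges n t) x y"
abbreviation (input) "ones k \<equiv> \<Sum>i=1..k. x i * y i"

lemma bits: "i \<in> {1..n} \<Longrightarrow> x i \<in> {0, 1}"
  using x by (auto simp: bitstrings_def PiE_iff)

lemma verts:
  assumes "c < t" "1 \<le> j" "j \<le> n"
  shows "Alice (query n c j) \<in> V" "Bob (query n c j) \<in> V"
    "Alice (reply n c j) \<in> V" "Bob (reply n c j) \<in> V"
    "{Alice (query n c j), Bob (query n c j)} \<in> E" "{Bob (reply n c j), Alice (reply n c j)} \<in> E"
  using code_bounds[of "2 * c" "2 * t" j n] code_bounds[of "Suc (2 * c)" "2 * t" j n] assms
  by (auto simp: gh_verts_def A0_verts_def A_verts_def B_verts_def gh_edges_def pipes_def)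

text \<open>The invariant after the first \<open>k\<close> positions: \<open>j\<close> is the last
  one of \<open>x\<close> so far, or 0. The bound on columns makes column \<open>k + 1\<close>
  fresh, and the visited vertex \<open>Bob (reply n c j)\<close> blocks the way back through the
  pipe.\<close>

definition at_alice :: "nat \<Rightarrow> nat \<Rightarrow> vertex list \<Rightarrow> nat \<Rightarrow> bool" where
  "at_alice k c p j \<longleftrightarrow>
     c < t \<and> path V E p \<and> hd p = Zero \<and> last p = reply_end n c j \<and>
     (\<forall>v \<in> set p. column n v \<le> k) \<and> (j = 0 \<longrightarrow> c = 0) \<and> (0 < j \<longrightarrow> Bob (reply n c j) \<in> set p) \<and>
     j \<le> k \<and> (j = 0 \<or> x j = 1) \<and> (\<forall>i. j < i \<and> i \<le> k \<longrightarrow> x i = 0)"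

text \<open>The final state on Bob's side: \<open>t \<le> c + y j\<close> says that
  \<open>bob_edges\<close> offers no reply to this query.\<close>

definition at_bob :: "vertex list \<Rightarrow> nat \<Rightarrow> nat \<Rightarrow> bool" where
  "at_bob p c j \<longleftrightarrow>
     path V E p \<and> hd p = Zero \<and> last p = Bob (query n c j) \<and> Alice (query n c j) \<in> set p \<and>
     c < t \<and> t \<le> c + y j \<and> 1 \<le> j \<and> j \<le> n"

text \<open>Induction on the positions: a zero of \<open>x\<close> leaves the path unchanged, and a
  one appends a query and, below the threshold, its reply.\<close>

lemma trace:
  assumes "k \<le> n"
  shows "(\<exists>p j. at_alice k (ones k) p j) \<or> t \<le> ones k \<and> (\<exists>p c j. at_bob p c j)"
  using assms
proof (induction k)
  case 0
  have "at_alice 0 0 [Zero] 0"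
    using t by (simp add: at_alice_def path_def reply_end_def gh_verts_def A0_verts_def)
  then show ?case by auto
next
  case (Suc k)
  let ?k = "Suc k"
  have k: "1 \<le> ?k" "?k \<le> n" "?k \<in> {1..n}" using Suc.prems by auto
  consider p j where "at_alice k (ones k) p j" | "t \<le> ones k" "\<exists>p c j. at_bob p c j"
    using Suc by auto
  then show ?case
  proof cases
    case 1
    define c where "c = ones k"
    have p: "c < t" "path V E p" "hd p = Zero" "last p = reply_end n c j"
        "\<forall>v \<in> set p. column n v \<le> k" "j = 0 \<longrightarrow> c = 0" "0 < j \<longrightarrow> Bob (reply n c j) \<in> set p"
        "j \<le> k" "j = 0 \<or> x j = 1" "\<forall>i. j < i \<and> i \<le> k \<longrightarrow> x i = 0"
      using 1 by (simp_all add: at_alice_def c_def)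
    have pne: "p \<noteq> []" using p(2) by (simp add: path_def)
    show ?thesis
    proof (cases "x ?k = 0")
      case True
      then have "at_alice ?k (ones ?k) p j"
        using p by (auto simp: at_alice_def c_def le_Suc_eq)
      then show ?thesis by blast
    next
      case False
      then have x1: "x ?k = 1" using bits[OF k(3)] by auto
      then have ones: "ones ?k = c + y ?k" by (simp add: c_def)
      \<comment> \<open>The path has so far stayed in the columns up to \<open>k\<close>.\<close>
      have new: "v \<notin> set p" if "column n v = ?k" for v
        using p(5) that by fastforce
      have "next_one n x j ?k"
        using p(8-10) x1 k by (auto simp: next_one_def)
      then have ask: "{reply_end n c j, Alice (query n c ?k)} \<in> E"
        using p(1,6) by (auto simp: gh_edges_def alice_edges_def)
      let ?q = "[Alice (query n c ?k), Bob (query n c ?k)]"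
      have q: "path V E ?q"
        using verts[OF p(1) k(1,2)] by (simp add: path_def)
      have pq: "path V E (p @ ?q)"
        by (rule path_append[OF p(2) q]) (use ask p(4) k new in \<open>auto simp: code_mod\<close>)
      show ?thesis
      proof (cases "c + y ?k < t")
        case False
        then have "at_bob (p @ ?q) c ?k"
          using pq p k pne by (auto simp: at_bob_def)
        then show ?thesis using False ones by auto
      next
        case True
        define d where "d = c + y ?k"
        have d: "d < t" using True by (simp add: d_def)
        let ?r = "[Bob (reply n d ?k), Alice (reply n d ?k)]"
        have r: "path V E ?r"
          using verts[OF d k(1,2)] by (simp add: path_def)
        have answer: "{Bob (query n c ?k), Bob (reply n d ?k)} \<in> E"
          using True k by (auto simp: gh_edges_def bob_edges_def d_def)
        \<comment> \<open>The query and the reply lie in the same new column and are told apart by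
          parity.\<close>
        have "Suc (2 * d) \<noteq> 2 * c" by presburger
        then have "set (p @ ?q) \<inter> set ?r = {}"
          using new k by (auto simp: code_mod code_eq_iff)
        then have "path V E ((p @ ?q) @ ?r)"
          using path_append[OF pq r] answer by simp
        then have "at_alice ?k d (p @ ?q @ ?r) ?k"
          using d p(3,5) k x1 pne by (auto simp: at_alice_def reply_end_def code_mod le_SucI)
        then show ?thesis using ones d_def by auto
      qed
    qed
  next
    case 2
    \<comment> \<open>The partial sums only grow, so the threshold remains reached.\<close>
    then show ?thesis by (simp add: trans_le_add1)
  qed
qed

text \<open>Alice's edges avoid Bob's vertices, and an edge of Bob at this query would need
  \<open>c + y j < t\<close>; only the pipe already traversed is left.\<close>

lemma bob_stuck:
  assumes "at_bob p c j"
  shows "last (gh_path (2 * t * Suc n) (alice_edges n t) (bob_edges n t) x y)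
    \<in> B_verts (2 * t * Suc n)"
proof -
  have p: "path V E p" "hd p = Zero" "last p = Bob (query n c j)" "Alice (query n c j) \<in> set p"
      "c < t" "t \<le> c + y j" "1 \<le> j" "j \<le> n"
    using assms by (auto simp: at_bob_def)
  have "u \<in> set p" if "{last p, u} \<in> E" for u
  proof -
    have "{Bob (query n c j), u} \<notin> alice_edges n t x"
      by (auto simp: alice_edges_def reply_end_def doubleton_eq_iff)
    moreover have "2 * a \<noteq> Suc (2 * b + 2 * d)" for a b d :: nat by presburger
    then have "{Bob (query n c j), u} \<notin> bob_edges n t y"
      using p(6,8) by (auto simp: bob_edges_def doubleton_eq_iff code_eq_iff)
    ultimately have "{Bob (query n c j), u} \<in> pipes (2 * t * Suc n)"
      using that p(3) unfolding gh_edges_def Un_iff by metis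
    then have "u = Alice (query n c j)" by (auto simp: pipes_def doubleton_eq_iff)
    then show ?thesis using p(4) by simp
  qed
  then have "last (gh_path (2 * t * Suc n) (alice_edges n t) (bob_edges n t) x y) = last p"
    by (rule last_gh_path[OF game_edges x y p(1,2)])
  then show ?thesis
    using p code_bounds[of "2 * c" "2 * t" j n] by (auto simp: B_verts_def)
qed

lemma alice_stuck:
  assumes "at_alice n c p j"
  shows "last (gh_path (2 * t * Suc n) (alice_edges n t) (bob_edges n t) x y)
    \<in> A0_verts (2 * t * Suc n)"
proof -
  have p: "c < t" "path V E p" "hd p = Zero" "last p = reply_end n c j" "j = 0 \<longrightarrow> c = 0"
      "0 < j \<longrightarrow> Bob (reply n c j) \<in> set p" "j \<le> n" "\<forall>i. j < i \<and> i \<le> n \<longrightarrow> x i = 0"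
    using assms by (auto simp: at_alice_def)
  have "u \<in> set p" if "{last p, u} \<in> E" for u
  proof -
    have "{reply_end n c j, u} \<notin> alice_edges n t x"
    proof
      assume "{reply_end n c j, u} \<in> alice_edges n t x"
      then obtain c' i i' where e: "{reply_end n c j, u} = {reply_end n c' i, Alice (query n c' i')}"
        "i = 0 \<longrightarrow> c' = 0" "next_one n x i i'"
        unfolding alice_edges_def mem_Collect_eq by blast
      \<comment> \<open>The edge must leave from \<open>j\<close> itself and lead to a later one of
        \<open>x\<close>, but none is left up to \<open>n\<close>.\<close>
      then have "i = j"
        using reply_end_eq_iff[of j n i c c'] reply_end_neq_query[of j n i' c c']
          next_one_le[OF e(3)] p by (auto simp: doubleton_eq_iff)
      then show False using e(3) p(8) by (auto simp: next_one_def)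
    qed
    moreover have "{reply_end n c j, u} \<notin> bob_edges n t y"
      by (auto simp: bob_edges_def reply_end_def doubleton_eq_iff)
    ultimately have "{reply_end n c j, u} \<in> pipes (2 * t * Suc n)"
      using that p(4) unfolding gh_edges_def Un_iff by metis
    \<comment> \<open>The tap has no pipe, which excludes \<open>j = 0\<close>.\<close>
    then have "0 < j \<and> u = Bob (reply n c j)"
      by (auto simp: pipes_def doubleton_eq_iff reply_end_def split: if_splits)
    then show ?thesis using p(6) by simp
  qed
  then have "last (gh_path (2 * t * Suc n) (alice_edges n t) (bob_edges n t) x y) = last p"
    by (rule last_gh_path[OF game_edges x y p(2,3)])
  then show ?thesis
    using p code_bounds[of "Suc (2 * c)" "2 * t" j n]
    by (auto simp: A0_verts_def A_verts_def reply_end_def)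
qed

end

section \<open>From the traced path to the size bounds\<close>

theorem GH_threshold_le:
  assumes "t \<ge> 1"
  shows "GH n (\<lambda>x y. if (\<Sum>i=1..n. x i * y i) \<ge> t then 1 else 0) \<le> enat (2 * t * Suc n)"
proof -
  have "gh_computes n (2 * t * Suc n) (alice_edges n t) (bob_edges n t)
      (\<lambda>x y. if (\<Sum>i=1..n. x i * y i) \<ge> t then 1 else 0)"
    unfolding gh_computes_def
  proof (intro ballI)
    fix x y assume xy: "x \<in> bitstrings n" "y \<in> bitstrings n"
    let ?ones = "\<Sum>i=1..n. x i * y i"
    let ?end = "last (gh_path (2 * t * Suc n) (alice_edges n t) (bob_edges n t) x y)"
    \<comment> \<open>The strict inequality comes from the clause \<open>c < t\<close> of
      \<open>at_alice\<close>, with \<open>c\<close> the full sum.\<close>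
    have "?ones < t \<and> ?end \<in> A0_verts (2 * t * Suc n) \<or>
        t \<le> ?ones \<and> ?end \<in> B_verts (2 * t * Suc n)"
      using trace[OF assms xy order_refl] alice_stuck[OF assms xy] bob_stuck[OF assms xy]
        at_alice_def[OF assms xy] by blast
    then show "((if ?ones \<ge> t then 1 else 0) = (0::nat) \<longrightarrow> ?end \<in> A0_verts (2 * t * Suc n)) \<and>
        ((if ?ones \<ge> t then 1 else 0) = (1::nat) \<longrightarrow> ?end \<in> B_verts (2 * t * Suc n))"
      by auto
  qed
  then show ?thesis unfolding GH_def using game_edges by (intro Inf_lower) blast
qed

theorem mainTheorem8:
  fixes n :: nat
  assumes "n \<ge> 1"
  shows "GH n (MAJ n) \<le> enat ((n + 2)\<^sup>2)"
proof -
  have "GH n (MAJ n) \<le> enat (2 * (n div 2 + 1) * Suc n)"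
    using GH_threshold_le[of "n div 2 + 1" n] by (simp add: MAJ_def[abs_def])
  \<comment> \<open>Factor by factor: \<open>2 * (n div 2) \<le> n\<close> and
    \<open>Suc n \<le> n + 2\<close>.\<close>
  also have "2 * (n div 2 + 1) * Suc n \<le> (n + 2) * (n + 2)"
    by (intro mult_le_mono) auto
  then have "enat (2 * (n div 2 + 1) * Suc n) \<le> enat ((n + 2)\<^sup>2)"
    by (simp add: power2_eq_square)
  finally show ?thesis .
qed

end
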